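(* Let $n\ge 2$ be divisible by $4$, let $D\subseteq\{d : d\mid n,\ 1\le d<n\}$, and let $\lambda_0,\dots,\lambda_{n-1}$ be the eigenvalues of $\mathrm{ICG}_n(D)$ indexed as below. Suppose $\mathrm{ICG}_n(D)$ has perfect state transfer. If $n/2\in D$ then all eigenvalues $\lambda_j$ are odd, and $\lambda_j=-1$ for every odd $j$ with $0\le j\le n-1$. If $n/2\notin D$ then all eigenvalues $\lambda_j$ are even, and $\lambda_j=0$ for every odd $j$ with $0\le j\le n-1$.
   Context: For $D\subseteq\{d : d\mid n,\ 1\le d<n\}$, $\mathrm{ICG}_n(D)$ is the graph on $\mathbb{Z}_n=\{0,\dots,n-1\}$ in which $a,b$ are adjacent iff $\gcd(a-b,n)\in D$. With $A$ its adjacency matrix and $F(t)=\exp(\mathrm{i}At)$, the graph has perfect state transfer if there are distinct vertices $a,b$ and $\tau>0$ with $|F(\tau)_{ab}|=1$. The Ramanujan function is $c(j,m)=\mu(t_{m,j})\,\varphi(m)/\varphi(t_{m,j})$ with $t_{m,j}=m/\gcd(m,j)$ (for integers $j\ge0$, $m\ge1$; $\gcd(m,0)=m$), where $\mu$ is the Möbius function and $\varphi$ Euler's function. The eigenvalues of $\mathrm{ICG}_n(D)$ are $\lambda_j=\sum_{d\in D}c(j,n/d)$, $j=0,\dots,n-1$ ($\lambda_j$ is the eigenvalue of the eigenvector $(\omega^{jk})_{k=0}^{n-1}$, $\omega=e^{2\pi\mathrm{i}/n}$). *)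

theory Defs
  imports
    Complex_Main
    "HOL-Computational_Algebra.Squarefree"
    "HOL-Number_Theory.Totient"
    "Jordan_Normal_Form.Char_Poly"
begin

definition icg_adj :: "nat \<Rightarrow> nat set \<Rightarrow> nat \<Rightarrow> nat \<Rightarrow> bool" where
  "icg_adj n D a b \<longleftrightarrow> nat (gcd (int a - int b) (int n)) \<in> D"

definition icg_adj_mat :: "nat \<Rightarrow> nat set \<Rightarrow> complex mat" where
  "icg_adj_mat n D = mat n n (\<lambda>(a, b). if icg_adj n D a b then 1 else 0)"

text \<open>The series in \<open>mat_exp\<close> converges for every square matrix: see \<open>summable_mat_exp\<close>.\<close>

definition mat_exp :: "complex mat \<Rightarrow> complex mat" where
  "mat_exp A = mat (dim_row A) (dim_row A) (\<lambda>(a, b). \<Sum>k. (A ^\<^sub>m k) $$ (a, b) / fact k)"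

definition icg_transfer :: "nat \<Rightarrow> nat set \<Rightarrow> real \<Rightarrow> complex mat" where
  "icg_transfer n D t = mat_exp ((\<i> * of_real t) \<cdot>\<^sub>m icg_adj_mat n D)"

definition icg_has_pst :: "nat \<Rightarrow> nat set \<Rightarrow> bool" where
  "icg_has_pst n D \<longleftrightarrow>
     (\<exists>a<n. \<exists>b<n. a \<noteq> b \<and> (\<exists>\<tau>>0. cmod (icg_transfer n D \<tau> $$ (a, b)) = 1))"

definition moebius_mu :: "nat \<Rightarrow> int" where
  "moebius_mu n = (if squarefree n then (-1) ^ card (prime_factors n) else 0)"

text \<open>The integer division in \<open>ramanujan_c\<close> is exact: see \<open>ramanujan_c_exact\<close>.\<close>

definition ramanujan_c :: "nat \<Rightarrow> nat \<Rightarrow> int" where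
  "ramanujan_c j m =
     (let t = m div gcd m j in moebius_mu t * int (totient m) div int (totient t))"

text \<open>
  \<open>icg_eigenvalue n D j\<close> is the eigenvalue of the adjacency matrix that belongs to the
  eigenvector \<open>icg_eigenvector n j\<close>: see \<open>icg_eigenvector_eigenvalue\<close>.
\<close>

definition icg_eigenvalue :: "nat \<Rightarrow> nat set \<Rightarrow> nat \<Rightarrow> int" where
  "icg_eigenvalue n D j = (\<Sum>d\<in>D. ramanujan_c j (n div d))"

definition icg_eigenvector :: "nat \<Rightarrow> nat \<Rightarrow> complex vec" where
  "icg_eigenvector n j = vec n (\<lambda>k. exp (2 * of_real pi * \<i> / of_nat n) ^ (j * k))"

lemma ramanujan_c_exact:
  assumes "m > 0"
  shows "real_of_int (ramanujan_c j m) =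
    real_of_int (moebius_mu (m div gcd m j)) * real (totient m) / real (totient (m div gcd m j))"
proof -
  define t where "t = m div gcd m j"
  have "t dvd m" unfolding t_def by (metis dvd_div_mult_self dvd_triv_left gcd_dvd1)
  hence "int (totient t) dvd int (totient m)" by (simp add: totient_dvd)
  hence "int (totient t) dvd moebius_mu t * int (totient m)" by simp
  thus ?thesis unfolding ramanujan_c_def Let_def t_def[symmetric]
    by (simp add: real_of_int_div)
qed

lemma summable_mat_exp:
  fixes A :: "complex mat"
  assumes A: "A \<in> carrier_mat n n" and a: "a < n" and b: "b < n"
  shows "summable (\<lambda>k. (A ^\<^sub>m k) $$ (a, b) / fact k)"
proof -
  define M where "M = (\<Sum>i<n. \<Sum>j<n. cmod (A $$ (i, j)))"
  have M0: "M \<ge> 0" unfolding M_def by (intro sum_nonneg) auto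
  have Mij: "cmod (A $$ (i, j)) \<le> M" if "i < n" "j < n" for i j
  proof -
    have "cmod (A $$ (i, j)) \<le> (\<Sum>j<n. cmod (A $$ (i, j)))"
      using that by (intro member_le_sum) auto
    also have "\<dots> \<le> M" unfolding M_def
      using that by (intro member_le_sum[of i _ "\<lambda>i. \<Sum>j<n. cmod (A $$ (i, j))"] sum_nonneg) auto
    finally show ?thesis .
  qed
  have bound: "cmod ((A ^\<^sub>m k) $$ (i, j)) \<le> (real n * M) ^ k" if "i < n" "j < n" for i j k
    using that
  proof (induction k arbitrary: i j)
    case 0
    thus ?case using A by auto
  next
    case (Suc k)
    have P: "A ^\<^sub>m k \<in> carrier_mat n n" using A by (rule pow_carrier_mat)
    have "(A ^\<^sub>m Suc k) $$ (i, j) = (\<Sum>l\<in>{0..<n}. (A ^\<^sub>m k) $$ (i, l) * A $$ (l, j))"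
      using Suc.prems A P by (simp add: scalar_prod_def)
    also have "cmod \<dots> \<le> (\<Sum>l\<in>{0..<n}. (real n * M) ^ k * M)"
      using Suc Mij M0 by (intro sum_norm_le) (auto simp: norm_mult intro!: mult_mono)
    also have "\<dots> = (real n * M) ^ Suc k" by simp
    finally show ?case .
  qed
  show ?thesis
  proof (rule summable_comparison_test')
    show "summable (\<lambda>k. (real n * M) ^ k / fact k)"
      using summable_exp[of "real n * M"] by (simp add: field_simps)
    show "norm ((A ^\<^sub>m k) $$ (a, b) / fact k) \<le> (real n * M) ^ k / fact k" for k
      using bound[OF a b, of k] by (simp add: norm_divide divide_right_mono)
  qed
qed

definition e_frac :: "nat \<Rightarrow> nat \<Rightarrow> complex" where
  "e_frac m x = cis (2 * pi * real x / real m)"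

lemma e_frac_add: "e_frac m (x + y) = e_frac m x * e_frac m y"
  by (simp add: e_frac_def cis_mult ring_distribs add_divide_distrib)

lemma e_frac_mult_self: "m > 0 \<Longrightarrow> e_frac m (m * q) = 1"
  using cis_multiple_2pi[of "real q"] by (simp add: e_frac_def mult.assoc)

lemma e_frac_mod: "m > 0 \<Longrightarrow> e_frac m (x mod m) = e_frac m x"
  by (metis e_frac_add e_frac_mult_self mult.commute mult_1 mult_div_mod_eq)

lemma e_frac_cancel: "g > 0 \<Longrightarrow> e_frac (g * m) (g * x) = e_frac m x"
  by (simp add: e_frac_def mult.assoc)

lemma e_frac_exp: "exp (2 * of_real pi * \<i> / of_nat n) ^ k = e_frac n k"
proof -
  have "exp (2 * of_real pi * \<i> / of_nat n) ^ k = exp (of_nat k * (2 * of_real pi * \<i> / of_nat n))"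
    by (rule exp_of_nat_mult[symmetric])
  also have "\<dots> = e_frac n k"
    unfolding e_frac_def cis_conv_exp by (simp add: field_simps)
  finally show ?thesis .
qed

lemma e_frac_sum_all:
  assumes "t > 0"
  shows "(\<Sum>k\<in>{0<..t}. e_frac t k) = (if t = 1 then 1 else 0)"
proof -
  have pw: "e_frac t k = e_frac t 1 ^ k" for k
  proof (induction k)
    case (Suc k)
    thus ?case using e_frac_add[of t 1 k] by simp
  qed (simp add: e_frac_def)
  have "(\<Sum>k\<in>{0<..t}. e_frac t k) = (\<Sum>k<t. e_frac t (Suc k))"
    by (rule sum.reindex_bij_witness[of _ Suc "\<lambda>k. k - 1"]) auto
  also have "\<dots> = e_frac t 1 * (\<Sum>k<t. e_frac t 1 ^ k)"
    by (subst pw) (simp add: sum_distrib_left)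
  also have "\<dots> = (if t = 1 then 1 else 0)"
  proof (cases "t = 1")
    case True
    thus ?thesis by (simp add: e_frac_def)
  next
    case False
    have "e_frac t 1 \<noteq> 1"
    proof
      assume "e_frac t 1 = 1"
      hence "cis (2 * pi / real t) = 1" by (simp add: e_frac_def)
      hence "cos (2 * pi / real t) = 1" by (simp add: complex_eq_iff)
      then obtain x :: int where "2 * pi / real t = of_int x * 2 * pi"
        using cos_one_2pi_int by blast
      hence "1 = real_of_int x * real t" using assms by (simp add: field_simps)
      hence "1 = x * int t" by (metis of_int_1 of_int_eq_iff of_int_mult of_int_of_nat_eq)
      hence "int t dvd 1" by (metis dvd_triv_right)
      thus False using False by simp
    qed
    moreover have "e_frac t 1 ^ t = 1"
      using pw[of t] e_frac_mult_self[OF assms, of 1] by simp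
    ultimately show ?thesis using False by (simp add: geometric_sum)
  qed
  finally show ?thesis .
qed

lemma prime_factorization_Prod:
  fixes S :: "nat set"
  assumes fin: "finite S" and pr: "\<And>p. p \<in> S \<Longrightarrow> prime p"
  shows "prime_factorization (\<Prod>S) = mset_set S"
proof -
  have "\<Prod>S = prod_mset (mset_set S)"
    by (simp add: prod_unfold_prod_mset)
  thus ?thesis using pr fin by (metis finite_set_mset_mset_set prime_factorization_prod_mset_primes)
qed

lemma moebius_divisor_sum:
  assumes "n > 0"
  shows "(\<Sum>d | d dvd n. moebius_mu d) = (if n = 1 then 1 else 0)"
proof -
  define P where "P = prime_factors n"
  have fP: "finite P" by (simp add: P_def)
  have *: "prime_factors (\<Prod>S) = S \<and> squarefree (\<Prod>S) \<and> \<Prod>S dvd n" if S: "S \<subseteq> P" for S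
  proof -
    have fS: "finite S" using S fP finite_subset by blast
    have pr: "\<And>p. p \<in> S \<Longrightarrow> prime p" using S by (auto simp: P_def)
    have pf: "prime_factorization (\<Prod>S) = mset_set S"
      using fS pr by (rule prime_factorization_Prod)
    have nz: "\<Prod>S \<noteq> 0" using fS pr by (metis not_prime_0 prod_zero_iff)
    have "multiplicity p (\<Prod>S) = 1" if "p \<in> S" for p
      using that pr pf fS by (metis count_mset_set(1) count_prime_factorization_prime)
    hence "squarefree (\<Prod>S)"
      using nz pf fS by (simp add: squarefree_factorial_semiring')
    moreover have "mset_set S \<subseteq># prime_factorization n"
      using subset_imp_msubset_mset_set[OF S fP] mset_set_set_mset_msubset[of "prime_factorization n"]
      unfolding P_def by (rule subset_mset.order_trans)
    hence "\<Prod>S dvd n" using nz assms by (subst prime_factorization_subset_iff_dvd[symmetric]) (auto simp: pf)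
    ultimately show ?thesis using fS by (simp add: pf)
  qed
  have inv: "\<Prod>(prime_factors d) = d" if sq: "squarefree d" for d :: nat
  proof -
    have d: "d \<noteq> 0" using sq by (metis not_squarefree_0)
    have "d = (\<Prod>p\<in>prime_factors d. p ^ multiplicity p d)"
      using d by (simp add: prod_prime_factors)
    also have "\<dots> = \<Prod>(prime_factors d)"
      using sq d by (intro prod.cong) (auto simp: squarefree_factorial_semiring')
    finally show ?thesis by simp
  qed
  have fin: "finite {d. d dvd n}" using assms by simp
  have "(\<Sum>d | d dvd n. moebius_mu d) = (\<Sum>d | d dvd n \<and> squarefree d. moebius_mu d)"
    using fin by (intro sum.mono_neutral_right) (auto simp: moebius_mu_def)
  also have "\<dots> = (\<Sum>S\<in>Pow P. (-1) ^ card S)"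
  proof (rule sum.reindex_bij_witness[of _ "\<lambda>S. \<Prod>S" prime_factors])
    fix d assume d: "d \<in> {d. d dvd n \<and> squarefree d}"
    thus "\<Prod>(prime_factors d) = d" using inv by blast
    show "prime_factors d \<in> Pow P"
      using d assms dvd_prime_factors[of n d] by (auto simp: P_def)
    show "(- 1) ^ card (prime_factors d) = moebius_mu d"
      using d by (simp add: moebius_mu_def)
  next
    fix S assume "S \<in> Pow P"
    thus "prime_factors (\<Prod>S) = S" "\<Prod>S \<in> {d. d dvd n \<and> squarefree d}" using * by auto
  qed
  also have "\<dots> = (\<Sum>S\<in>Pow P. (\<Prod>x\<in>S. -1) * (\<Prod>x\<in>P-S. 1))"
    by simp
  also have "\<dots> = (\<Prod>x\<in>P. -1 + (1::int))"
    by (rule prod_add[OF fP, symmetric])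
  also have "\<dots> = (if n = 1 then 1 else 0)"
  proof (cases "n = 1")
    case False
    then obtain p where "p \<in> P"
      using assms by (metis P_def all_not_in_conv nat_dvd_1_iff_1 not_gr_zero prime_factorization_empty_iff set_mset_eq_empty_iff)
    thus ?thesis using False fP by (simp add: prod_zero_iff card_gt_0_iff) blast
  qed (simp add: P_def)
  finally show ?thesis .
qed

lemma sum_gcd_classes:
  assumes "n > 0"
  shows "(\<Sum>k\<in>{k\<in>{0<..n}. gcd k n = d}. f k) =
         (if d dvd n then \<Sum>k\<in>totatives (n div d). f (k * d) else 0)"
proof (cases "d dvd n")
  case True
  show ?thesis
    using sum.reindex_bij_betw[OF bij_betw_totatives_gcd_eq[OF True assms], of f] True by simp
next
  case False
  hence empty: "{k\<in>{0<..n}. gcd k n = d} = {}" by auto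
  show ?thesis using False unfolding empty by simp
qed

lemma e_frac_sum_primitive:
  assumes "t > 0"
  shows "(\<Sum>k\<in>totatives t. e_frac t k) = of_int (moebius_mu t)"
  using assms
proof (induction t rule: less_induct)
  case (less t)
  have fin: "finite {d. d dvd t}" using less.prems by simp
  define S where "S = (\<lambda>d. \<Sum>k\<in>totatives d. e_frac d k)"
  have "(\<Sum>k\<in>{0<..t}. e_frac t k) = (\<Sum>d | d dvd t. \<Sum>k\<in>{k\<in>{0<..t}. gcd k t = d}. e_frac t k)"
    using fin by (intro sum.group[symmetric]) auto
  also have "\<dots> = (\<Sum>d | d dvd t. S (t div d))"
  proof (rule sum.cong)
    fix d assume "d \<in> {d. d dvd t}"
    then obtain q where q: "t = d * q" by auto
    have "e_frac t (k * d) = e_frac q k" for k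
      using q less.prems e_frac_cancel[of d q k] by (simp add: mult.commute)
    thus "(\<Sum>k\<in>{k\<in>{0<..t}. gcd k t = d}. e_frac t k) = S (t div d)"
      using q less.prems by (subst sum_gcd_classes) (auto simp: S_def)
  qed simp
  also have "\<dots> = (\<Sum>d | d dvd t. S d)"
    using less.prems
    by (intro sum.reindex_bij_witness[of _ "\<lambda>d. t div d" "\<lambda>d. t div d"]) (auto elim!: dvdE)
  finally have "(\<Sum>d | d dvd t. S d) = of_int (\<Sum>d | d dvd t. moebius_mu d)"
    using e_frac_sum_all[OF less.prems] moebius_divisor_sum[OF less.prems] by (auto split: if_splits)
  moreover have split: "{d. d dvd t} = insert t {d. d dvd t \<and> d < t}"
    using less.prems by (auto dest: dvd_imp_le)
  moreover have "S d = of_int (moebius_mu d)" if "d dvd t" "d < t" for d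
    using less.IH[of d] that less.prems unfolding S_def by (metis dvd_pos_nat)
  hence "(\<Sum>d | d dvd t \<and> d < t. S d) = of_int (\<Sum>d | d dvd t \<and> d < t. moebius_mu d)"
    by simp
  ultimately have "S t = of_int (moebius_mu t)"
    by simp
  thus ?case by (simp add: S_def)
qed

lemma mod_totatives:
  assumes "m > 0" "coprime k m"
  shows "\<exists>r\<in>totatives m. [r = k] (mod m)"
proof (cases "k mod m = 0")
  case True
  hence "m = 1" using assms by (metis coprime_common_divisor_nat dvd_refl mod_0_imp_dvd)
  thus ?thesis by (intro bexI[of _ 1]) (auto simp: cong_def)
next
  case False
  thus ?thesis using assms
    by (intro bexI[of _ "k mod m"]) (auto simp: in_totatives_iff cong_def less_imp_le)
qed

lemma sum_totatives_mult:
  assumes m: "m > 0" and w: "coprime w m" and f: "\<And>x y. [x = y] (mod m) \<Longrightarrow> f x = f y"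
  shows "(\<Sum>k\<in>totatives m. f (w * k)) = (\<Sum>k\<in>totatives m. (f k :: complex))"
proof -
  have inj: "x = y" if "x \<in> totatives m" "y \<in> totatives m" "[x = y] (mod m)" for x y
  proof (cases "m = 1")
    case False
    hence "m > 1" using m by simp
    hence "x < m" "y < m" using that totatives_less by blast+
    thus ?thesis using that(3) by (simp add: cong_def)
  qed (use that in auto)
  define r where "r k = (SOME r. r \<in> totatives m \<and> [r = w * k] (mod m))" for k
  have r: "r k \<in> totatives m \<and> [r k = w * k] (mod m)" if "k \<in> totatives m" for k
  proof -
    have "coprime (w * k) m" using that w by (simp add: in_totatives_iff)
    hence "\<exists>r. r \<in> totatives m \<and> [r = w * k] (mod m)" using mod_totatives[OF m] by blast
    thus ?thesis unfolding r_def by (rule someI_ex)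
  qed
  have injr: "inj_on r (totatives m)"
  proof (rule inj_onI)
    fix x y assume xy: "x \<in> totatives m" "y \<in> totatives m" "r x = r y"
    hence "[w * x = w * y] (mod m)" using r by (metis cong_sym cong_trans)
    hence "[x = y] (mod m)" using w by (simp add: cong_mult_lcancel_nat)
    thus "x = y" using inj xy by blast
  qed
  have im: "r ` totatives m = totatives m"
    using injr r by (intro endo_inj_surj) auto
  have "(\<Sum>k\<in>totatives m. f (w * k)) = (\<Sum>k\<in>totatives m. f (r k))"
    using r f by (intro sum.cong) (auto simp: cong_sym)
  also have "\<dots> = (\<Sum>k\<in>totatives m. f k)"
    using sum.reindex[OF injr, of f] im by simp
  finally show ?thesis .
qed

lemma coprime_lift:
  fixes t m u :: nat
  assumes "m > 0" and "coprime u t"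
  shows "\<exists>w. coprime w m \<and> [w = u] (mod t)"
proof -
  define P where "P = {p \<in> prime_factors m. \<not> p dvd t \<and> \<not> p dvd u}"
  have fP: "finite P" by (simp add: P_def)
  define w where "w = u + t * \<Prod>P"
  have "\<not> p dvd w" if p: "prime p" "p dvd m" for p
  proof (cases "p dvd u")
    case True
    hence nt: "\<not> p dvd t" using assms(2) p(1) by (meson coprime_common_divisor not_prime_unit)
    have "\<not> p dvd \<Prod>P"
    proof
      assume "p dvd \<Prod>P"
      then obtain q where "q \<in> P" "p dvd q" using p(1) fP by (auto simp: prime_dvd_prod_iff)
      hence "p = q" using p(1) unfolding P_def
        by (metis (no_types, lifting) in_prime_factors_imp_prime mem_Collect_eq primes_dvd_imp_eq)
      thus False using \<open>q \<in> P\<close> True by (simp add: P_def)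
    qed
    hence "\<not> p dvd t * \<Prod>P" using nt p(1) by (simp add: prime_dvd_mult_iff)
    thus ?thesis using True by (simp add: w_def dvd_add_right_iff)
  next
    case False
    have "p dvd t * \<Prod>P"
    proof (cases "p dvd t")
      case False
      hence "p \<in> P" using \<open>\<not> p dvd u\<close> p assms(1) by (simp add: P_def prime_factors_dvd)
      thus ?thesis using fP by (simp add: dvd_prod_eqI)
    qed simp
    thus ?thesis using False by (simp add: w_def dvd_add_left_iff)
  qed
  hence "coprime w m"
    using prime_factor_nat[of "gcd w m"] by (metis coprime_iff_gcd_eq_1 gcd_dvd1 gcd_dvd2 dvd_trans)
  moreover have "[w = u] (mod t)" by (simp add: w_def cong_def)
  ultimately show ?thesis by blast
qed

lemma ramanujan_sum:
  assumes m: "m > 0"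
  shows "(\<Sum>k\<in>totatives m. e_frac m (j * k)) = of_int (ramanujan_c j m)"
proof -
  define g where "g = gcd m j"
  define t where "t = m div g"
  define i where "i = j div g"
  have g: "g > 0" using m by (simp add: g_def)
  have mt: "m = g * t" and ji: "j = g * i" by (simp_all add: g_def t_def i_def)
  have t: "t > 0" using m mt by (cases t) auto
  have cop: "coprime i t"
    unfolding i_def t_def g_def using m by (metis coprime_commute div_gcd_coprime not_gr_zero)
  have per: "e_frac t x = e_frac t y" if "[x = y] (mod t)" for x y
    using that t by (metis cong_def e_frac_mod)
  have perm: "[x = y] (mod t)" if "[x = y] (mod m)" for x y
    using that mt by (metis cong_modulus_mult_nat mult.commute)
  let ?S = "\<Sum>k\<in>totatives m. e_frac t (i * k)"
  have unit_shift: "(\<Sum>k\<in>totatives m. e_frac t (i * (u * k))) = ?S" if "u \<in> totatives t" for u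
  proof -
    obtain w where w: "coprime w m" "[w = u] (mod t)"
      using coprime_lift[OF m, of u t] \<open>u \<in> totatives t\<close> by (auto simp: in_totatives_iff)
    have "(\<Sum>k\<in>totatives m. e_frac t (i * (u * k))) = (\<Sum>k\<in>totatives m. e_frac t (i * (w * k)))"
      by (intro sum.cong refl per cong_mult cong_refl cong_sym[OF w(2)])
    also have "\<dots> = ?S"
      by (rule sum_totatives_mult[OF m w(1), of "\<lambda>k. e_frac t (i * k)"])
         (intro per cong_mult cong_refl perm)
    finally show ?thesis .
  qed
  have unit_sum: "(\<Sum>u\<in>totatives t. e_frac t (i * (u * k))) = of_int (moebius_mu t)"
    if k: "k \<in> totatives m" for k
  proof -
    have "coprime (i * k) t" using cop k mt by (simp add: in_totatives_iff)
    hence "(\<Sum>u\<in>totatives t. e_frac t ((i * k) * u)) = (\<Sum>u\<in>totatives t. e_frac t u)"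
      by (rule sum_totatives_mult[OF t, where f = "e_frac t"]) (rule per)
    thus ?thesis using e_frac_sum_primitive[OF t] by (simp add: mult_ac)
  qed
  have "of_nat (totient t) * ?S = (\<Sum>u\<in>totatives t. \<Sum>k\<in>totatives m. e_frac t (i * (u * k)))"
    using unit_shift by (simp add: totient_def)
  also have "\<dots> = (\<Sum>k\<in>totatives m. \<Sum>u\<in>totatives t. e_frac t (i * (u * k)))"
    by (rule sum.swap)
  also have "\<dots> = of_nat (totient m) * of_int (moebius_mu t)"
    using unit_sum by (simp add: totient_def)
  finally have S: "of_nat (totient t) * ?S = of_nat (totient m) * of_int (moebius_mu t)" .
  have "int (totient t) dvd moebius_mu t * int (totient m)"
    using mt by (simp add: totient_dvd)
  hence "int (totient t) * ramanujan_c j m = int (totient m) * moebius_mu t"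
    unfolding ramanujan_c_def Let_def g_def[symmetric] t_def[symmetric] by (simp add: mult.commute)
  hence "of_int (int (totient t) * ramanujan_c j m) = (of_int (int (totient m) * moebius_mu t) :: complex)"
    by (rule arg_cong)
  hence "of_nat (totient t) * ?S = of_nat (totient t) * of_int (ramanujan_c j m)"
    using S by simp
  moreover have "of_nat (totient t) \<noteq> (0::complex)" using t by simp
  ultimately have "?S = of_int (ramanujan_c j m)" by simp
  moreover have "e_frac m (j * k) = e_frac t (i * k)" for k
    using e_frac_cancel[OF g, of t "i * k"] mt ji by (simp add: mult.assoc)
  ultimately show ?thesis by simp
qed

lemma sum_shift_mod:
  fixes f :: "nat \<Rightarrow> complex"
  assumes n: "n > 0" and per: "\<And>x. f (x mod n) = f x"
  shows "(\<Sum>b<n. f (a + b)) = (\<Sum>k\<in>{0<..n}. f k)"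
proof (induction a)
  case 0
  have "(\<Sum>b<n. f b) = (\<Sum>b\<in>insert 0 {0<..<n}. f b)"
    using n by (intro sum.cong) auto
  also have "\<dots> = f n + (\<Sum>b\<in>{0<..<n}. f b)"
    using per[of n] by simp
  also have "\<dots> = (\<Sum>b\<in>insert n {0<..<n}. f b)" by simp
  also have "insert n {0<..<n} = {0<..n}" using n by auto
  finally show ?case by simp
next
  case (Suc a)
  have "(\<Sum>b<n. f (Suc a + b)) + f a = (\<Sum>b<Suc n. f (a + b))"
    by (simp add: sum.lessThan_Suc_shift del: sum.lessThan_Suc)
  also have "\<dots> = (\<Sum>b<n. f (a + b)) + f a"
    using per[of "a + n"] per[of a] by simp
  finally show ?case using Suc by simp
qed

theorem icg_eigenvector_eigenvalue:
  assumes n: "n > 0" and D: "D \<subseteq> {d. d dvd n \<and> 1 \<le> d \<and> d < n}"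
  shows "eigenvector (icg_adj_mat n D) (icg_eigenvector n j) (of_int (icg_eigenvalue n D j))"
proof -
  let ?v = "icg_eigenvector n j"
  have fD: "finite D" by (rule finite_subset[OF D]) simp
  have v: "?v $ k = e_frac n (j * k)" if "k < n" for k
    using that by (simp add: icg_eigenvector_def e_frac_exp)
  have nz: "?v \<noteq> 0\<^sub>v n"
  proof
    assume "?v = 0\<^sub>v n"
    hence "?v $ 0 = 0" using n by simp
    thus False using v[OF n] by (simp add: e_frac_def)
  qed
  have row: "(\<Sum>b<n. (if icg_adj n D a b then 1 else 0) * e_frac n (j * b)) =
      of_int (icg_eigenvalue n D j) * e_frac n (j * a)" if a: "a < n" for a
  proof -
    define f where "f x = (if gcd x n \<in> D then e_frac n (j * x) else 0)" for x
    have per: "f (x mod n) = f x" for x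
    proof -
      have "e_frac n (j * (x mod n)) = e_frac n (j * x)"
        using e_frac_mod[OF n] by (metis mod_mult_right_eq)
      thus ?thesis by (simp add: f_def gcd.commute flip: gcd_red_nat)
    qed
    have "(if icg_adj n D a b then 1 else 0) * e_frac n (j * b) = e_frac n (j * a) * f ((n - a) + b)" for b
    proof -
      have "gcd (int a - int b) (int n) = gcd (int ((n - a) + b)) (int n)"
      proof -
        have "int ((n - a) + b) = int n - (int a - int b)" using a by simp
        thus ?thesis by (metis gcd.commute gcd_diff2 gcd_neg1_int minus_diff_eq)
      qed
      hence "nat (gcd (int a - int b) (int n)) = gcd ((n - a) + b) n"
        by (metis gcd_int_int_eq nat_int)
      moreover have "e_frac n (j * a) * e_frac n (j * ((n - a) + b)) = e_frac n (j * b)"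
      proof -
        have "j * a + j * ((n - a) + b) = n * j + j * b"
          using a by (metis add.assoc add.commute distrib_left le_add_diff_inverse less_imp_le mult.commute)
        thus ?thesis using e_frac_mult_self[OF n, of j] by (simp flip: e_frac_add) (simp add: e_frac_add)
      qed
      ultimately show ?thesis by (simp add: icg_adj_def f_def)
    qed
    hence "(\<Sum>b<n. (if icg_adj n D a b then 1 else 0) * e_frac n (j * b)) =
        e_frac n (j * a) * (\<Sum>b<n. f ((n - a) + b))"
      by (simp add: sum_distrib_left)
    also have "(\<Sum>b<n. f ((n - a) + b)) = (\<Sum>k\<in>{0<..n}. f k)"
      by (rule sum_shift_mod) (use n per in auto)
    also have "\<dots> = (\<Sum>k\<in>{k\<in>{0<..n}. gcd k n \<in> D}. e_frac n (j * k))"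
      unfolding f_def by (rule sum.inter_filter[symmetric]) simp
    also have "\<dots> = (\<Sum>d\<in>D. \<Sum>k\<in>{k\<in>{k\<in>{0<..n}. gcd k n \<in> D}. gcd k n = d}. e_frac n (j * k))"
      using fD by (intro sum.group[symmetric]) auto
    also have "\<dots> = (\<Sum>d\<in>D. of_int (ramanujan_c j (n div d)))"
    proof (rule sum.cong)
      fix d assume d: "d \<in> D"
      then obtain q where q: "n = d * q" "d > 0" using D by (auto simp: dvd_def)
      have q0: "q > 0" using q n by (cases q) auto
      have "{k\<in>{k\<in>{0<..n}. gcd k n \<in> D}. gcd k n = d} = {k\<in>{0<..n}. gcd k n = d}"
        using d by auto
      moreover have "e_frac n (j * (k * d)) = e_frac q (j * k)" for k
        using e_frac_cancel[of d q "j * k"] q by (simp add: mult_ac)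
      moreover have "d dvd n" "n div d = q" using q by simp_all
      ultimately show "(\<Sum>k\<in>{k\<in>{k\<in>{0<..n}. gcd k n \<in> D}. gcd k n = d}. e_frac n (j * k)) =
          of_int (ramanujan_c j (n div d))"
        using ramanujan_sum[OF q0, of j] sum_gcd_classes[OF n, where d = d and f = "\<lambda>k. e_frac n (j * k)"] by presburger
    qed simp
    also have "\<dots> = of_int (icg_eigenvalue n D j)" by (simp add: icg_eigenvalue_def)
    finally show ?thesis by (simp add: mult.commute)
  qed
  have "icg_adj_mat n D *\<^sub>v ?v = of_int (icg_eigenvalue n D j) \<cdot>\<^sub>v ?v"
  proof (rule eq_vecI)
    fix a assume "a < dim_vec (of_int (icg_eigenvalue n D j) \<cdot>\<^sub>v ?v)"
    hence a: "a < n" by (simp add: icg_eigenvector_def)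
    have "(icg_adj_mat n D *\<^sub>v ?v) $ a =
        (\<Sum>b\<in>{0..<n}. (if icg_adj n D a b then 1 else 0) * ?v $ b)"
      using a by (simp add: icg_adj_mat_def icg_eigenvector_def scalar_prod_def)
    also have "\<dots> = (\<Sum>b<n. (if icg_adj n D a b then 1 else 0) * e_frac n (j * b))"
      using v by (intro sum.cong) auto
    also have "\<dots> = (of_int (icg_eigenvalue n D j) \<cdot>\<^sub>v ?v) $ a"
      using row[OF a] v[OF a] a by (simp add: icg_eigenvector_def)
    finally show "(icg_adj_mat n D *\<^sub>v ?v) $ a = (of_int (icg_eigenvalue n D j) \<cdot>\<^sub>v ?v) $ a" .
  qed (simp add: icg_adj_mat_def icg_eigenvector_def)
  thus ?thesis using nz unfolding eigenvector_def
    by (simp add: icg_adj_mat_def icg_eigenvector_def)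
qed

end

(*
  Expanding exp(iAt) in the eigenvectors writes n * F(t)_ab as a sum of n unit complex numbers
  exp(i t lambda_l) w^l with w = omega^(a-b), so perfect state transfer forces all of them to be
  equal.  Since lambda_(n-1) = lambda_1, this gives w = -1, and then lambda_i and lambda_j have the
  same parity whenever i and j do.

  For odd j, c(j,m) = 0 if 4 divides m and c(j,2m) = -c(j,m) for odd m, so that
  lambda_j = sum b_m c(j,m) over the odd divisors m of n, where
  b_m = [n/m in D] - [n/(2m) in D].  Because the sum of c(j,m) over m | d is d if d | j and 0
  otherwise, writing b_m as the sum of e_d over the multiples d of m turns this into
  lambda_j = sum of d e_d over d | j.  The parity of lambda_j being the same for all odd j, e_d is
  even for d > 1, hence so is b_m for m > 1; as b_m is -1, 0 or 1, it vanishes, and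
  lambda_j = b_1 = -[n/2 in D].  The even indices are settled by lambda_0 = sum phi(n/d).
*)

theory Submission
  imports Defs
begin

section \<open>Characters of the cyclic group and entries of the matrix exponential\<close>

lemma inj_on_e_frac: "n > 0 \<Longrightarrow> inj_on (e_frac n) {..<n}"
  using bij_betw_roots_unity[of n] by (simp add: bij_betw_def e_frac_def [abs_def])

lemma norm_e_frac [simp]: "cmod (e_frac n k) = 1"
  by (simp add: e_frac_def)

lemma cnj_e_frac_mult_self [simp]: "cnj (e_frac n k) * e_frac n k = 1"
  by (simp add: e_frac_def cis_cnj cis_mult)

lemma e_frac_power: "e_frac n k ^ l = e_frac n (l * k)"
  by (simp add: e_frac_def DeMoivre algebra_simps)

lemma e_frac_ratio_power_self:
  "n > 0 \<Longrightarrow> (e_frac n a * cnj (e_frac n b)) ^ n = 1"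
  by (simp add: power_mult_distrib e_frac_power e_frac_mult_self flip: complex_cnj_power)

lemma e_frac_ratio_eq_1_iff:
  assumes "a < n" "b < n"
  shows "e_frac n a * cnj (e_frac n b) = 1 \<longleftrightarrow> a = b"
proof
  assume "e_frac n a * cnj (e_frac n b) = 1"
  hence "e_frac n a * (cnj (e_frac n b) * e_frac n b) = e_frac n b"
    by (metis mult.assoc mult_1)
  hence "e_frac n a = e_frac n b" by simp
  thus "a = b" using inj_on_e_frac[of n] assms by (auto simp: inj_on_def)
qed (metis cnj_e_frac_mult_self mult.commute)

text \<open>A geometric sum: its ratio \<open>w\<close> is an n-th root of unity, and
  \<open>w = 1\<close> only for \<open>a = b\<close> because the roots \<open>e_frac n k\<close>
  with \<open>k < n\<close> are distinct.\<close>

lemma e_frac_orthogonal: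
  assumes "a < n" "b < n"
  shows "(\<Sum>l<n. e_frac n (l * a) * cnj (e_frac n (l * b))) = (if a = b then of_nat n else 0)"
proof -
  define w where "w = e_frac n a * cnj (e_frac n b)"
  have "(\<Sum>l<n. e_frac n (l * a) * cnj (e_frac n (l * b))) = (\<Sum>l<n. w ^ l)"
    by (simp add: w_def power_mult_distrib e_frac_power flip: complex_cnj_power)
  also have "\<dots> = (if w = 1 then of_nat n else (w ^ n - 1) / (w - 1))"
    by (simp add: geometric_sum)
  finally show ?thesis
    using e_frac_ratio_power_self[of n a b] e_frac_ratio_eq_1_iff[OF assms] assms
    by (simp add: w_def)
qed

text \<open>Orthogonality of the eigenvectors recovers each entry of \<open>B ^\<^sub>m i\<close>
  from the powers \<open>\<theta> l ^ i\<close>; summing the exponential series termwise turns these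
  into \<open>exp (\<theta> l)\<close>.\<close>

lemma mat_exp_entry_fourier:
  assumes B: "B \<in> carrier_mat n n"
    and ev: "\<And>l. l < n \<Longrightarrow> eigenvector B (icg_eigenvector n l) (\<theta> l)"
    and a: "a < n" and b: "b < n"
  shows "of_nat n * mat_exp B $$ (a, b) =
    (\<Sum>l<n. exp (\<theta> l) * (e_frac n (l * a) * cnj (e_frac n (l * b))))"
proof -
  define E where "E l = e_frac n (l * a) * cnj (e_frac n (l * b))" for l
  have v: "icg_eigenvector n l $ k = e_frac n (l * k)" if "k < n" for l k
    using that by (simp add: icg_eigenvector_def e_frac_exp)
  have row: "(\<Sum>k<n. (B ^\<^sub>m i) $$ (a, k) * e_frac n (l * k)) = \<theta> l ^ i * e_frac n (l * a)"
    if "l < n" for i l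
  proof -
    have P: "B ^\<^sub>m i \<in> carrier_mat n n" using B by (rule pow_carrier_mat)
    have "(\<Sum>k<n. (B ^\<^sub>m i) $$ (a, k) * e_frac n (l * k)) = (B ^\<^sub>m i *\<^sub>v icg_eigenvector n l) $ a"
      using carrier_matD[OF P] a
      by (simp add: scalar_prod_def lessThan_atLeast0 icg_eigenvector_def e_frac_exp)
    also have "\<dots> = (\<theta> l ^ i \<cdot>\<^sub>v icg_eigenvector n l) $ a"
      using eigenvector_pow[OF B ev[OF that]] by simp
    also have "\<dots> = \<theta> l ^ i * e_frac n (l * a)"
      using a v by (simp add: icg_eigenvector_def)
    finally show ?thesis .
  qed
  have pow: "of_nat n * (B ^\<^sub>m i) $$ (a, b) = (\<Sum>l<n. \<theta> l ^ i * E l)" for i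
  proof -
    have "(\<Sum>l<n. \<theta> l ^ i * E l) =
        (\<Sum>l<n. (\<Sum>k<n. (B ^\<^sub>m i) $$ (a, k) * e_frac n (l * k)) * cnj (e_frac n (l * b)))"
      by (simp add: row E_def mult.assoc)
    \<comment> \<open>With the sum over \<open>l\<close> innermost, orthogonality leaves only the
      term \<open>k = b\<close>.\<close>
    also have "\<dots> = (\<Sum>k<n. (B ^\<^sub>m i) $$ (a, k) *
        (\<Sum>l<n. e_frac n (l * k) * cnj (e_frac n (l * b))))"
      by (simp only: sum_distrib_left sum_distrib_right mult.assoc) (rule sum.swap)
    also have "\<dots> = (\<Sum>k<n. if k = b then (B ^\<^sub>m i) $$ (a, k) * of_nat n else 0)"
      using b by (intro sum.cong) (auto simp: e_frac_orthogonal)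
    also have "\<dots> = of_nat n * (B ^\<^sub>m i) $$ (a, b)"
      using b by (simp add: mult.commute)
    finally show ?thesis by simp
  qed
  have "(\<lambda>i. of_nat n * ((B ^\<^sub>m i) $$ (a, b) / fact i)) sums (of_nat n * mat_exp B $$ (a, b))"
    using summable_sums[OF summable_mat_exp[OF B a b]] B a b
    by (intro sums_mult) (simp add: mat_exp_def)
  moreover have "(\<lambda>i. \<Sum>l<n. \<theta> l ^ i /\<^sub>R fact i * E l) sums (\<Sum>l<n. exp (\<theta> l) * E l)"
    by (intro sums_sum sums_mult2 exp_converges)
  moreover have "of_nat n * ((B ^\<^sub>m i) $$ (a, b) / fact i) = (\<Sum>l<n. \<theta> l ^ i /\<^sub>R fact i * E l)" for i
    using pow[of i] by (simp add: sum_divide_distrib scaleR_conv_of_real field_simps)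
  ultimately show ?thesis unfolding E_def by (simp add: sums_unique2)
qed

section \<open>Phases and parities forced by perfect state transfer\<close>

text \<open>Equality case of the triangle inequality. After multiplication by \<open>cnj u\<close>,
  where \<open>u\<close> is the direction of the sum, the real parts are at most 1 and average to 1,
  so every term equals \<open>u\<close>.\<close>

lemma norm_sum_eq_card_imp_const:
  fixes z :: "'a \<Rightarrow> complex"
  assumes fin: "finite S" and unit: "\<And>i. i \<in> S \<Longrightarrow> cmod (z i) = 1"
    and norm: "cmod (sum z S) = real (card S)" and ij: "i \<in> S" "j \<in> S"
  shows "z i = z j"
proof -
  define u where "u = sgn (sum z S)"
  have card: "card S > 0" using fin ij by (auto simp: card_gt_0_iff)
  have u: "cmod u = 1" using norm card by (auto simp: u_def norm_sgn)
  have eq: "sum z S = of_nat (card S) * u"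
    unfolding u_def sgn_eq norm using card by simp
  have uu: "u * cnj u = 1" using u by (simp add: complex_norm_square[symmetric])
  have "(\<Sum>i\<in>S. z i * cnj u) = of_nat (card S)"
    using eq uu by (simp add: mult.assoc flip: sum_distrib_right)
  hence "(\<Sum>i\<in>S. Re (z i * cnj u)) = real (card S)"
    by (metis Re_sum of_nat_eq_iff complex_Re_of_nat)
  hence s0: "(\<Sum>i\<in>S. 1 - Re (z i * cnj u)) = 0"
    by (simp add: sum_subtractf)
  have le: "Re (z i * cnj u) \<le> 1" if "i \<in> S" for i
    using complex_Re_le_cmod[of "z i * cnj u"] unit[OF that] u by (simp only: norm_mult) simp
  have "z i = u" if i: "i \<in> S" for i
  proof -
    have "1 - Re (z i * cnj u) = 0"
      using s0 le i fin by (subst (asm) sum_nonneg_eq_0_iff) auto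
    hence re: "Re (z i * cnj u) = 1" by simp
    have "cmod (z i * cnj u) = 1" using unit[OF i] u by (simp add: norm_mult)
    hence "Im (z i * cnj u) = 0"
      using re cmod_power2[of "z i * cnj u"] by simp
    hence "z i * cnj u = 1" using re by (simp add: complex_eq_iff)
    thus "z i = u" using uu by (metis mult.assoc mult.commute mult_1)
  qed
  thus ?thesis using ij by simp
qed

text \<open>\<open>ramanujan_c\<close> sees its first argument only through the gcd with a divisor
  of \<open>n\<close>, and a divisor of \<open>n\<close> divides \<open>n - j\<close> iff it divides
  \<open>j\<close>.\<close>

lemma icg_eigenvalue_reflect:
  assumes D: "D \<subseteq> {d. d dvd n \<and> 1 \<le> d \<and> d < n}" and j: "j \<le> n"
  shows "icg_eigenvalue n D (n - j) = icg_eigenvalue n D j"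
proof -
  have "ramanujan_c (n - j) (n div d) = ramanujan_c j (n div d)" if "d \<in> D" for d
  proof -
    have "d dvd n" using that D by blast
    hence "n div d dvd n" by (metis dvd_div_mult_self dvd_triv_left)
    have "c dvd n - j \<longleftrightarrow> c dvd j" if "c dvd n" for c
      using that j by (metis diff_diff_cancel dvd_diff_nat)
    hence "gcd (n div d) (n - j) = gcd (n div d) j"
      using \<open>n div d dvd n\<close> by (intro gcd_unique_nat[THEN iffD1]) (metis dvd_trans gcd_dvd1 gcd_dvd2 gcd_greatest)
    thus ?thesis by (simp add: ramanujan_c_def)
  qed
  thus ?thesis by (simp add: icg_eigenvalue_def)
qed

text \<open>Each unit summand equals the one at index 0, where the power of \<open>w\<close> is 1;
  the sign in the conclusion is \<open>w = -1\<close>.\<close>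

lemma pst_phases:
  assumes n: "n > 0" and D: "D \<subseteq> {d. d dvd n \<and> 1 \<le> d \<and> d < n}"
    and pst: "icg_has_pst n D"
  obtains \<tau> :: real where "\<And>j. j < n \<Longrightarrow>
    cis (\<tau> * icg_eigenvalue n D j) * (-1) ^ j = cis (\<tau> * icg_eigenvalue n D 0)"
proof -
  obtain a b \<tau> where ab: "a < n" "b < n" "a \<noteq> b"
    and norm: "cmod (icg_transfer n D \<tau> $$ (a, b)) = 1"
    using pst unfolding icg_has_pst_def by blast
  define L where "L j = icg_eigenvalue n D j" for j
  define A where "A = icg_adj_mat n D"
  define w where "w = e_frac n a * cnj (e_frac n b)"
  define z where "z l = cis (\<tau> * L l) * w ^ l" for l
  have A: "A \<in> carrier_mat n n" by (simp add: A_def icg_adj_mat_def)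
  have ev: "eigenvector ((\<i> * of_real \<tau>) \<cdot>\<^sub>m A) (icg_eigenvector n l) (\<i> * of_real \<tau> * of_int (L l))" for l
  proof -
    have v: "icg_eigenvector n l \<in> carrier_vec n" by (simp add: icg_eigenvector_def)
    have "(c \<cdot>\<^sub>m A) *\<^sub>v icg_eigenvector n l = c \<cdot>\<^sub>v (A *\<^sub>v icg_eigenvector n l)" for c
      using A v by (intro eq_vecI) auto
    thus ?thesis
      using icg_eigenvector_eigenvalue[OF n D, of l] A v
      unfolding eigenvector_def A_def[symmetric] L_def[symmetric]
      by (auto simp: smult_smult_assoc)
  qed
  have wl: "w ^ l = e_frac n (l * a) * cnj (e_frac n (l * b))" for l
    by (simp add: w_def power_mult_distrib e_frac_power flip: complex_cnj_power)
  have "of_nat n * icg_transfer n D \<tau> $$ (a, b) =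
      (\<Sum>l<n. exp (\<i> * of_real \<tau> * of_int (L l)) * w ^ l)"
    unfolding icg_transfer_def A_def[symmetric] wl
    by (rule mat_exp_entry_fourier) (use A ev ab in auto)
  also have "\<dots> = sum z {..<n}"
    by (simp add: z_def cis_conv_exp mult.assoc)
  finally have "cmod (sum z {..<n}) = real (card {..<n})"
    using norm by (metis card_lessThan mult.right_neutral norm_mult norm_of_nat)
  moreover have "cmod (z l) = 1" for l
    by (simp add: z_def w_def norm_mult norm_power)
  ultimately have const: "z i = z j" if "i < n" "j < n" for i j
    using that by (intro norm_sum_eq_card_imp_const[of "{..<n}" z]) auto
  have w1: "w \<noteq> 1" and wn: "w ^ n = 1"
    using e_frac_ratio_eq_1_iff[of a n b] e_frac_ratio_power_self[OF n, of a b] ab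
    by (auto simp: w_def)
  have n2: "n \<ge> 2" using ab by linarith
  have "L (n - 1) = L 1"
    unfolding L_def using D n by (intro icg_eigenvalue_reflect) auto
  hence "w ^ (n - 1) = w"
    using const[of "n - 1" 1] n2 by (simp add: z_def)
  \<comment> \<open>Multiply by \<open>w\<close>. The right side is 1, so \<open>w\<close> is 1 or
    -1, and \<open>a \<noteq> b\<close> excludes 1.\<close>
  hence "w ^ 2 = w ^ n"
    using n2 by (metis One_nat_def Suc_pred n power2_eq_square power_Suc)
  hence "w = -1" using w1 wn by (simp add: power2_eq_1_iff)
  thus thesis using that[of \<tau>] const[of _ 0] n by (simp add: z_def L_def)
qed

text \<open>With \<open>c = cis \<tau>\<close>, the power of \<open>c\<close> to
  \<open>L i - L j\<close> is 1 and the power to \<open>L 0 - L 1\<close> is -1. The power to the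
  product of both exponents is therefore 1 and also -1 to the power \<open>L i - L j\<close>, so
  this difference cannot be odd.\<close>

lemma pst_eigenvalue_parity:
  assumes n: "n \<ge> 2" and D: "D \<subseteq> {d. d dvd n \<and> 1 \<le> d \<and> d < n}"
    and pst: "icg_has_pst n D"
    and ij: "i < n" "j < n" "even i \<longleftrightarrow> even j"
  shows "even (icg_eigenvalue n D i) \<longleftrightarrow> even (icg_eigenvalue n D j)"
proof (rule ccontr)
  define L where "L k = icg_eigenvalue n D k" for k
  assume "\<not> ?thesis"
  hence odd: "odd (L i - L j)" by (simp add: L_def)
  from n have "n > 0" by simp
  then obtain \<tau> :: real where \<tau>: "\<And>k. k < n \<Longrightarrow> cis (\<tau> * L k) * (-1) ^ k = cis (\<tau> * L 0)"
    using pst_phases[OF _ D pst] unfolding L_def by blast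
  define c where "c = cis \<tau>"
  \<comment> \<open>The differences of eigenvalues may be negative, hence integer powers.\<close>
  have pw: "c powi (x - y) = cis (\<tau> * x) / cis (\<tau> * y)" for x y :: int
    by (simp add: c_def cis_power_int cis_divide algebra_simps)
  have "cis (\<tau> * L i) = cis (\<tau> * L j)"
    using \<tau>[of i] \<tau>[of j] ij by (cases "even i") (auto simp: minus_equation_iff)
  hence 1: "c powi (L i - L j) = 1"
    unfolding pw by simp
  have "- cis (\<tau> * L 1) = cis (\<tau> * L 0)"
    using \<tau>[of 1] n by simp
  hence 2: "c powi (L 0 - L 1) = -1"
    unfolding pw by (simp add: field_simps)
  have "(c powi (L 0 - L 1)) powi (L i - L j) = (c powi (L i - L j)) powi (L 0 - L 1)"
    by (metis mult.commute power_int_mult)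
  thus False unfolding 1 2 using odd by (simp add: power_int_minus_left)
qed

section \<open>Identities for the Ramanujan function\<close>

text \<open>The reduced fractions with denominators dividing \<open>d\<close> are exactly the
  fractions k/d with 0 < k \<le> d, so the double sum over totatives is a full sum of d-th roots of
  unity.\<close>

lemma sum_ramanujan_c_divisors:
  assumes d: "d > 0"
  shows "(\<Sum>m | m dvd d. ramanujan_c r m) = (if d dvd r then int d else 0)"
proof -
  have fin: "finite {m. m dvd d}" using d by simp
  have "of_int (\<Sum>m | m dvd d. ramanujan_c r m) =
      (\<Sum>m | m dvd d. \<Sum>k\<in>totatives m. e_frac m (r * k))"
    using d by (simp add: ramanujan_sum dvd_pos_nat)
  \<comment> \<open>Replacing \<open>m\<close> by its complementary divisor makes it the gcd of
    numerator and \<open>d\<close>, as in \<open>sum_gcd_classes\<close>.\<close>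
  also have "\<dots> = (\<Sum>m | m dvd d. \<Sum>k\<in>totatives (d div m). e_frac (d div m) (r * k))"
    using d
    by (rule_tac sum.reindex_bij_witness[of _ "\<lambda>m. d div m" "\<lambda>m. d div m"]) (auto elim!: dvdE)
  also have "\<dots> = (\<Sum>m | m dvd d. \<Sum>k\<in>{k\<in>{0<..d}. gcd k d = m}. e_frac d (r * k))"
  proof (rule sum.cong)
    fix m assume "m \<in> {m. m dvd d}"
    then obtain q where q: "d = m * q" by auto
    have "e_frac d (r * (k * m)) = e_frac q (r * k)" for k
      using q d e_frac_cancel[of m q "r * k"] by (simp add: mult_ac)
    thus "(\<Sum>k\<in>totatives (d div m). e_frac (d div m) (r * k)) =
        (\<Sum>k\<in>{k\<in>{0<..d}. gcd k d = m}. e_frac d (r * k))"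
      using q d by (subst sum_gcd_classes) auto
  qed simp
  also have "\<dots> = (\<Sum>k\<in>{0<..d}. e_frac d (r * k))"
    using fin by (intro sum.group) auto
  also have "\<dots> = (\<Sum>k<d. e_frac d (r * (0 + k)))"
    using e_frac_mod[OF d]
    by (intro sum_shift_mod[OF d, of "\<lambda>k. e_frac d (r * k)", symmetric]) (metis mod_mult_right_eq)
  \<comment> \<open>Orthogonality is stated for indices below \<open>d\<close>, hence
    \<open>r mod d\<close>; index 0 supplies the trivial second factor.\<close>
  also have "\<dots> = (\<Sum>l<d. e_frac d (l * (r mod d)) * cnj (e_frac d (l * 0)))"
  proof (rule sum.cong)
    fix l
    have "e_frac d (r * l) = e_frac d (l * (r mod d))"
      using e_frac_mod[OF d] by (metis mod_mult_right_eq mult.commute)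
    thus "e_frac d (r * (0 + l)) = e_frac d (l * (r mod d)) * cnj (e_frac d (l * 0))"
      by (simp add: e_frac_def)
  qed simp
  also have "\<dots> = (if r mod d = 0 then of_nat d else 0)"
    using d by (subst e_frac_orthogonal) auto
  also have "\<dots> = of_int (if d dvd r then int d else 0)"
    by (simp add: dvd_eq_mod_eq_0)
  finally show ?thesis by (simp only: of_int_eq_iff)
qed

lemma moebius_mu_double: "odd t \<Longrightarrow> moebius_mu (2 * t) = - moebius_mu t"
proof -
  assume t: "odd t"
  hence cop: "coprime 2 t" and nz: "t \<noteq> 0" by (auto intro: Nat.gr0I)
  have sq: "squarefree (2 * t) \<longleftrightarrow> squarefree t"
    using cop squarefree_mult_coprime[OF cop squarefree_prime[OF two_is_prime_nat]]
    by (auto dest: squarefree_multD)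
  have "prime_factors (2 * t) = insert 2 (prime_factors t)"
    using nz by (simp add: prime_factors_product prime_factorization_prime)
  moreover have "2 \<notin> prime_factors t" using t by auto
  ultimately show ?thesis by (simp add: moebius_mu_def sq)
qed

text \<open>An odd \<open>j\<close> has the same gcd with \<open>m\<close> and \<open>2 * m\<close>,
  so \<open>t\<close> doubles: the Moebius value changes sign and both totients stay the
  same.\<close>

lemma ramanujan_c_double:
  assumes "odd j" "odd m"
  shows "ramanujan_c j (2 * m) = - ramanujan_c j m"
proof -
  have g: "gcd (2 * m) j = gcd m j"
    using assms by (simp add: gcd_mult_left_left_cancel)
  define t where "t = m div gcd m j"
  have t: "odd t" using assms unfolding t_def by (metis dvd_div_mult_self dvd_mult2 gcd_dvd1)
  have tt: "2 * m div gcd (2 * m) j = 2 * t"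
    unfolding g t_def by (simp add: div_mult_swap)
  have tot: "totient (2 * k) = totient k" if "odd k" for k
    using that by (simp add: totient_mult_coprime)
  \<comment> \<open>Exactness of the integer division is what lets the sign move out of the
    quotient.\<close>
  have "int (totient t) dvd moebius_mu t * int (totient m)"
    by (metis t_def dvd_div_mult_self dvd_triv_left gcd_dvd1 totient_dvd of_nat_dvd_iff dvd_mult)
  thus ?thesis using assms t
    unfolding ramanujan_c_def Let_def tt t_def[symmetric]
    by (simp add: moebius_mu_double tot dvd_neg_div)
qed

text \<open>Dividing by an odd gcd keeps the factor 4, so the Moebius value is 0.\<close>

lemma ramanujan_c_four_dvd:
  assumes "odd j" "4 dvd m"
  shows "ramanujan_c j m = 0"
proof -
  have "coprime 4 (gcd m j)"
    using assms(1) by (metis coprime_power_left_iff coprime_left_2_iff_odd dvd_trans gcd_dvd2 zero_less_numeral num_double power2_eq_square numeral_times_numeral)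
  hence "4 dvd m div gcd m j"
    using assms(2) by (metis coprime_dvd_mult_left_iff dvd_div_mult_self gcd_dvd1)
  hence "2\<^sup>2 dvd m div gcd m j" by simp
  hence "\<not> squarefree (m div gcd m j)"
    unfolding squarefree_def by (metis nat_dvd_1_iff_1 numeral_eq_one_iff semiring_norm(85))
  thus ?thesis by (simp add: ramanujan_c_def moebius_mu_def)
qed

section \<open>Parity of integer combinations of Ramanujan functions\<close>

text \<open>The system is triangular for divisibility. Elements are inserted in decreasing order:
  the new \<open>x\<close> is positive and smaller than all the others, hence a multiple of none of
  them, so \<open>e x\<close> can be chosen to solve its own equation without disturbing the earlier
  ones.\<close>

lemma ex_multiples_sum_inverse:
  fixes S :: "nat set" and b :: "nat \<Rightarrow> int"
  assumes "finite S" and "0 \<notin> S"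
  shows "\<exists>e. \<forall>m\<in>S. b m = (\<Sum>d | d \<in> S \<and> m dvd d. e d)"
  using assms
proof (induction S rule: finite_linorder_min_induct)
  case empty
  show ?case by simp
next
  case (insert x S)
  then obtain e where e: "\<And>m. m \<in> S \<Longrightarrow> b m = (\<Sum>d | d \<in> S \<and> m dvd d. e d)" by auto
  define e' where "e' = e(x := b x - (\<Sum>d | d \<in> S \<and> x dvd d. e d))"
  have same: "(\<Sum>d | d \<in> S \<and> m dvd d. e' d) = (\<Sum>d | d \<in> S \<and> m dvd d. e d)" for m
    using insert.hyps by (intro sum.cong) (auto simp: e'_def)
  have "b m = (\<Sum>d | d \<in> insert x S \<and> m dvd d. e' d)" if m: "m \<in> insert x S" for m
  proof (cases "m = x")
    case True
    have "{d. d \<in> insert x S \<and> m dvd d} = insert x {d. d \<in> S \<and> x dvd d}" using True by auto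
    moreover have "x \<notin> S" using insert.hyps by auto
    ultimately show ?thesis using True insert.hyps by (simp add: same) (simp add: e'_def)
  next
    case False
    hence "m \<in> S" "x < m" using m insert.hyps by auto
    hence "{d. d \<in> insert x S \<and> m dvd d} = {d. d \<in> S \<and> m dvd d}"
      using insert.prems by (auto dest: dvd_imp_le)
    thus ?thesis using e[OF \<open>m \<in> S\<close>] by (simp add: same)
  qed
  thus ?case by blast
qed

lemma ramanujan_combination_parity:
  fixes S :: "nat set" and b :: "nat \<Rightarrow> int"
  assumes fin: "finite S" and odd: "\<And>m. m \<in> S \<Longrightarrow> odd m"
    and closed: "\<And>d m. d \<in> S \<Longrightarrow> m dvd d \<Longrightarrow> m \<in> S"
    and par: "\<And>r. r \<in> S \<Longrightarrow> even ((\<Sum>m\<in>S. b m * ramanujan_c r m) - (\<Sum>m\<in>S. b m * ramanujan_c 1 m))"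
    and m: "m \<in> S" "m \<noteq> 1"
  shows "even (b m)"
proof -
  have nz: "0 \<notin> S" using odd by force
  obtain e where e: "\<And>m. m \<in> S \<Longrightarrow> b m = (\<Sum>d | d \<in> S \<and> m dvd d. e d)"
    using ex_multiples_sum_inverse[OF fin nz] by blast
  have B: "(\<Sum>m\<in>S. b m * ramanujan_c r m) = (\<Sum>d | d \<in> S \<and> d dvd r. e d * int d)" for r
  proof -
    have "(\<Sum>m\<in>S. b m * ramanujan_c r m) = (\<Sum>m\<in>S. \<Sum>d | d \<in> S \<and> m dvd d. e d * ramanujan_c r m)"
      by (intro sum.cong refl) (simp add: e sum_distrib_right)
    \<comment> \<open>As \<open>S\<close> is closed under divisors, the inner sum now runs over all
      divisors of \<open>d\<close>.\<close>
    also have "\<dots> = (\<Sum>d\<in>S. \<Sum>m | m \<in> S \<and> m dvd d. e d * ramanujan_c r m)"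
      by (rule sum.swap_restrict[OF fin fin])
    also have "\<dots> = (\<Sum>d\<in>S. if d dvd r then e d * int d else 0)"
    proof (rule sum.cong)
      fix d assume d: "d \<in> S"
      hence "{m. m \<in> S \<and> m dvd d} = {m. m dvd d}" "d > 0" using closed nz by (auto intro: Nat.gr0I)
      thus "(\<Sum>m | m \<in> S \<and> m dvd d. e d * ramanujan_c r m) = (if d dvd r then e d * int d else 0)"
        by (simp add: sum_ramanujan_c_divisors flip: sum_distrib_left)
    qed simp
    also have "\<dots> = (\<Sum>d | d \<in> S \<and> d dvd r. e d * int d)"
      using fin by (simp add: sum.inter_filter)
    finally show ?thesis .
  qed
  have ev: "even (e r)" if "r \<in> S" "r \<noteq> 1" for r
    using that
  proof (induction r rule: less_induct)
    case (less r)
    have S1: "1 \<in> S" using closed[OF less.prems(1)] by simp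
    \<comment> \<open>Apart from \<open>e 1\<close> and \<open>e r * int r\<close>, the sum for
      \<open>r\<close> has only terms that are even by induction. Subtracting the sum for 1 cancels
      \<open>e 1\<close>, and \<open>r\<close> is odd.\<close>
    let ?T = "{d. d \<in> S \<and> d dvd r} - {1, r}"
    have fT: "finite ?T" using fin by simp
    have T: "{d. d \<in> S \<and> d dvd r} = insert 1 (insert r ?T)" using S1 less.prems by auto
    have r0: "r > 0" using less.prems nz by (auto intro: Nat.gr0I)
    have "even (\<Sum>d\<in>?T. e d * int d)"
      using r0 by (intro dvd_sum) (auto intro!: dvd_mult2 less.IH dest!: dvd_imp_le)
    moreover have "{d. d \<in> S \<and> d dvd 1} = {1}" using S1 by auto
    moreover have "(\<Sum>d | d \<in> S \<and> d dvd r. e d * int d) = e 1 + (e r * int r + (\<Sum>d\<in>?T. e d * int d))"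
      using less.prems fT by (subst T) simp
    ultimately have "even (e r * int r)"
      using par[OF less.prems(1)] unfolding B by simp
    thus ?case using odd[OF less.prems(1)] by simp
  qed
  \<comment> \<open>The expansion of \<open>b m\<close> thus avoids \<open>e 1\<close>, the only
    coefficient of unknown parity.\<close>
  have "d \<noteq> 1" if "m dvd d" for d using that m by auto
  thus ?thesis unfolding e[OF m(1)] using ev by (intro dvd_sum) auto
qed

section \<open>Eigenvalues at odd indices and at index 0\<close>

text \<open>The substitution \<open>m = n div d\<close> moves \<open>D\<close> from the index set
  into 0-1 coefficients.\<close>

lemma icg_eigenvalue_conv_sum_divisors:
  assumes D: "D \<subseteq> {d. d dvd n \<and> 1 \<le> d \<and> d < n}" and n: "n > 0"
  shows "icg_eigenvalue n D j = (\<Sum>m | m dvd n. of_bool (n div m \<in> D) * ramanujan_c j m)"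
proof -
  have inv: "n div (n div d) = d" "n div d dvd n" if "d \<in> D" for d
  proof -
    have "d dvd n" using D that by blast
    then obtain q where "n = d * q" ..
    thus "n div (n div d) = d" "n div d dvd n" using n by auto
  qed
  have "icg_eigenvalue n D j = (\<Sum>m | m dvd n \<and> n div m \<in> D. ramanujan_c j m)"
    unfolding icg_eigenvalue_def
    using inv n by (intro sum.reindex_bij_witness[of _ "\<lambda>m. n div m" "\<lambda>m. n div m"]) auto
  also have "\<dots> = (\<Sum>m | m dvd n. of_bool (n div m \<in> D) * ramanujan_c j m)"
    using n by (intro sum.mono_neutral_cong_left) auto
  finally show ?thesis .
qed

text \<open>A divisor of \<open>n\<close> is odd, twice an odd divisor, or a multiple of 4. The last
  kind contributes 0, and each \<open>2 * m\<close> pairs with \<open>m\<close> under a sign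
  change.\<close>

lemma icg_eigenvalue_odd:
  assumes D: "D \<subseteq> {d. d dvd n \<and> 1 \<le> d \<and> d < n}" and n: "n > 0" "even n" and j: "odd j"
  shows "icg_eigenvalue n D j = (\<Sum>m | m dvd n \<and> odd m.
    (of_bool (n div m \<in> D) - of_bool (n div (2 * m) \<in> D)) * ramanujan_c j m)"
proof -
  define f where "f m = of_bool (n div m \<in> D) * ramanujan_c j m" for m
  let ?S = "{m. m dvd n \<and> odd m}"
  have fin: "finite {m. m dvd n}" using n by simp
  have dbl: "2 * m dvd n" if "m \<in> ?S" for m
    using that n by (simp add: divides_mult)
  have "icg_eigenvalue n D j = (\<Sum>m | m dvd n. f m)"
    unfolding f_def by (rule icg_eigenvalue_conv_sum_divisors[OF D n(1)])
  also have "\<dots> = (\<Sum>m\<in>?S \<union> (*) 2 ` ?S. f m)"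
  proof (rule sum.mono_neutral_right[OF fin])
    show "?S \<union> (*) 2 ` ?S \<subseteq> {m. m dvd n}" using dbl by auto
    show "\<forall>m\<in>{m. m dvd n} - (?S \<union> (*) 2 ` ?S). f m = 0"
    proof
      fix m assume m: "m \<in> {m. m dvd n} - (?S \<union> (*) 2 ` ?S)"
      then obtain k where k: "m = 2 * k" by auto
      hence "k dvd n" using m by (auto intro: dvd_mult_right)
      hence "even k" using m k by auto
      hence "4 dvd m" using k by auto
      thus "f m = 0" using ramanujan_c_four_dvd[OF j] by (simp add: f_def)
    qed
  qed
  also have "\<dots> = (\<Sum>m\<in>?S. f m) + (\<Sum>m\<in>(*) 2 ` ?S. f m)"
    using fin by (intro sum.union_disjoint) auto
  also have "(\<Sum>m\<in>(*) 2 ` ?S. f m) = (\<Sum>m\<in>?S. f (2 * m))"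
    by (subst sum.reindex) (auto simp: inj_on_def)
  also have "(\<Sum>m\<in>?S. f m) + (\<Sum>m\<in>?S. f (2 * m)) = (\<Sum>m\<in>?S. f m + f (2 * m))"
    by (simp add: sum.distrib)
  finally show ?thesis
    using ramanujan_c_double[OF j] by (auto simp: f_def algebra_simps intro!: sum.cong)
qed

lemma pst_eigenvalue_odd:
  assumes n: "n \<ge> 2" "even n" and D: "D \<subseteq> {d. d dvd n \<and> 1 \<le> d \<and> d < n}"
    and pst: "icg_has_pst n D" and j: "odd j"
  shows "icg_eigenvalue n D j = - of_bool (n div 2 \<in> D)"
proof -
  define b :: "nat \<Rightarrow> int" where "b m = of_bool (n div m \<in> D) - of_bool (n div (2 * m) \<in> D)" for m
  let ?S = "{m. m dvd n \<and> odd m}"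
  have n0: "n > 0" using n by simp
  hence fin: "finite ?S" by simp
  have lam: "icg_eigenvalue n D j = (\<Sum>m\<in>?S. b m * ramanujan_c j m)" if "odd j" for j
    unfolding b_def using icg_eigenvalue_odd[OF D n0 n(2) that] .
  have b0: "b m = 0" if m: "m \<in> ?S" "m \<noteq> 1" for m
  proof -
    have "even (b m)"
    proof (rule ramanujan_combination_parity[OF fin _ _ _ m])
      fix r assume r: "r \<in> ?S"
      \<comment> \<open>\<open>r\<close> is odd and \<open>n\<close> is even, so \<open>r\<close> is
        a proper divisor and a valid index.\<close>
      have "r < n" using r n n0 by (metis dvd_imp_le le_neq_implies_less mem_Collect_eq)
      hence "even (icg_eigenvalue n D r) \<longleftrightarrow> even (icg_eigenvalue n D 1)"
        using r n by (intro pst_eigenvalue_parity[OF n(1) D pst]) auto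
      thus "even ((\<Sum>m\<in>?S. b m * ramanujan_c r m) - (\<Sum>m\<in>?S. b m * ramanujan_c 1 m))"
        using lam[of r] lam[of 1] r by simp
    qed (auto intro: dvd_trans)
    \<comment> \<open>A difference of two truth values that is even must be 0.\<close>
    thus ?thesis by (auto simp: b_def split: if_splits)
  qed
  have "icg_eigenvalue n D j = (\<Sum>m\<in>{1}. b m * ramanujan_c j m)"
    unfolding lam[OF j] using fin b0 by (intro sum.mono_neutral_right) auto
  also have "\<dots> = b 1" by (simp add: ramanujan_c_def moebius_mu_def)
  \<comment> \<open>The first half of \<open>b 1\<close> vanishes because \<open>n\<close> itself is
    not in \<open>D\<close>.\<close>
  also have "\<dots> = - of_bool (n div 2 \<in> D)" using D by (auto simp: b_def)
  finally show ?thesis .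
qed

text \<open>The summand for \<open>d\<close> is the totient of \<open>n div d\<close>, which is even
  above 2. Only \<open>d = n div 2\<close> gives the argument 2, with totient 1.\<close>

lemma icg_eigenvalue_0_parity:
  assumes D: "D \<subseteq> {d. d dvd n \<and> 1 \<le> d \<and> d < n}" and n: "n > 0" "even n"
  shows "even (icg_eigenvalue n D 0) \<longleftrightarrow> n div 2 \<notin> D"
proof -
  have c0: "ramanujan_c 0 m = int (totient m)" if "m > 0" for m
    using that by (simp add: ramanujan_c_def moebius_mu_def)
  have fD: "finite D" by (rule finite_subset[OF D]) simp
  have ev: "even (ramanujan_c 0 (n div d))" if "d \<in> D" "d \<noteq> n div 2" for d
  proof -
    have "d dvd n" using D that by blast
    then obtain q where q: "n = d * q" ..
    have "q \<noteq> 0" "q \<noteq> 1" using q n D that(1) by auto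
    moreover have "q \<noteq> 2" using q that(2) by auto
    ultimately have "q > 2" by simp
    thus ?thesis using q n c0[of q] totient_even[of q] by auto
  qed
  hence rest: "even (\<Sum>d\<in>D - {n div 2}. ramanujan_c 0 (n div d))"
    by (intro dvd_sum) auto
  show ?thesis
  proof (cases "n div 2 \<in> D")
    case True
    have "n div (n div 2) = 2" using n by auto
    thus ?thesis using True rest fD c0[of 2]
      by (simp add: icg_eigenvalue_def sum.remove[OF fD True])
  next
    case False
    thus ?thesis using rest by (simp add: icg_eigenvalue_def)
  qed
qed

theorem mainTheorem2:
  fixes n :: nat and D :: "nat set"
  assumes "n \<ge> 2" and "4 dvd n"
    and "D \<subseteq> {d. d dvd n \<and> 1 \<le> d \<and> d < n}"
    and "icg_has_pst n D"
  shows "(n div 2 \<in> D \<longrightarrow>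
            (\<forall>j<n. odd (icg_eigenvalue n D j)) \<and>
            (\<forall>j<n. odd j \<longrightarrow> icg_eigenvalue n D j = -1)) \<and>
         (n div 2 \<notin> D \<longrightarrow>
            (\<forall>j<n. even (icg_eigenvalue n D j)) \<and>
            (\<forall>j<n. odd j \<longrightarrow> icg_eigenvalue n D j = 0))"
proof -
  have n: "n > 0" "even n" using assms(1,2) by (auto elim: dvdE)
  have odd_j: "icg_eigenvalue n D j = - of_bool (n div 2 \<in> D)" if "odd j" for j
    using pst_eigenvalue_odd[OF assms(1) n(2) assms(3,4) that] .
  \<comment> \<open>Even indices share the parity at index 0; at odd indices it is read off from the
    value -1 or 0.\<close>
  have "even (icg_eigenvalue n D j) \<longleftrightarrow> n div 2 \<notin> D" if "j < n" for j
  proof (cases "even j")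
    case True
    thus ?thesis
      using pst_eigenvalue_parity[OF assms(1,3,4) that n(1)] icg_eigenvalue_0_parity[OF assms(3) n]
      by simp
  next
    case False
    thus ?thesis using odd_j by simp
  qed
  thus ?thesis using odd_j by auto
qed

end
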